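(* Let $\mathcal{H}$ be a finite-dimensional complex Hilbert space, $\hat A$ a Hermitian operator on $\mathcal{H}$, $|\psi_i\rangle\in\mathcal{H}$ a unit vector, and $\hat F=\sum_{k=1}^{n}|f_k\rangle\langle f_k|$ a projector with $|f_1\rangle,\dots,|f_n\rangle$ orthonormal, $n\ge1$. For $\theta\in\mathbb{R}$ let $|\psi_\theta\rangle=e^{-i\theta\hat A}|\psi_i\rangle$, and assume $\langle\psi_\theta|f_k\rangle\neq0$ for all $k$. Put $$p_{\theta k}^{ps}=|\langle\psi_\theta|f_k\rangle|^2,\qquad p_\theta^{ps}=\sum_{k=1}^n p_{\theta k}^{ps},\qquad A_w^k=\frac{\langle\psi_\theta|\hat A|f_k\rangle}{\langle\psi_\theta|f_k\rangle}.$$ Then the postselected quantum Fisher information $\mathcal{I}_Q(\theta|\psi_\theta^{ps})$ satisfies $$\mathcal{I}_Q(\theta|\psi_\theta^{ps})\,(p_\theta^{ps})^2=4\sum_{1\le i<j\le n}p_{\theta i}^{ps}\,p_{\theta j}^{ps}\,\left|A_w^i-A_w^j\right|^2 .$$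
   Context: The unnormalized postselected state is $|\Psi_\theta^{ps}\rangle=\hat F|\psi_\theta\rangle$, and $|\dot\Psi_\theta^{ps}\rangle=\partial_\theta|\Psi_\theta^{ps}\rangle$. The postselected quantum Fisher information is $$\mathcal{I}_Q(\theta|\psi_\theta^{ps})=\frac{4}{p_\theta^{ps}}\langle\dot\Psi_\theta^{ps}|\dot\Psi_\theta^{ps}\rangle-\frac{4}{(p_\theta^{ps})^2}\left|\langle\dot\Psi_\theta^{ps}|\Psi_\theta^{ps}\rangle\right|^2 .$$ The numbers $A_w^k$ are called the (intrinsic) weak values of $\hat A$. *)

theory Defs
  imports "HOL-Analysis.Analysis"
begin

text \<open>
  Finite-dimensional complex Hilbert spaces.  \<^class>\<open>euclidean_space\<close> is the class of
  (nonzero) finite-dimensional real inner product spaces; the extension adds multiplication by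
  complex scalars and a Hermitian inner product whose real part is the real inner product, so
  that norm, topology and derivatives are those of the complex Hilbert space.  Following the
  bra-ket convention, \<open>cinner x y\<close> stands for \<open>\<langle>x|y\<rangle>\<close>, antilinear in the first argument.
\<close>

class complex_euclidean_space = euclidean_space +
  fixes scaleC :: "complex \<Rightarrow> 'a \<Rightarrow> 'a" (infixr \<open>*\<^sub>C\<close> 75)
    and cinner :: "'a \<Rightarrow> 'a \<Rightarrow> complex"
  assumes scaleC_add_right: "a *\<^sub>C (x + y) = a *\<^sub>C x + a *\<^sub>C y"
    and scaleC_add_left: "(a + b) *\<^sub>C x = a *\<^sub>C x + b *\<^sub>C x"
    and scaleC_scaleC: "a *\<^sub>C (b *\<^sub>C x) = (a * b) *\<^sub>C x"
    and scaleR_scaleC: "r *\<^sub>R x = complex_of_real r *\<^sub>C x"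
    and cinner_commute: "cinner x y = cnj (cinner y x)"
    and cinner_add_right: "cinner x (y + z) = cinner x y + cinner x z"
    and cinner_scaleC_right: "cinner x (a *\<^sub>C y) = a * cinner x y"
    and inner_eq_Re_cinner: "inner x y = Re (cinner x y)"

lemma vector_space_scaleC:
  "vector_space (scaleC :: complex \<Rightarrow> 'a \<Rightarrow> 'a::complex_euclidean_space)"
proof
  show "1 *\<^sub>C x = x" for x :: 'a
    using scaleR_scaleC[of 1 x] by simp
qed (simp_all add: scaleC_add_right scaleC_add_left scaleC_scaleC)

lemma cinner_self_eq_norm:
  fixes x :: "'a::complex_euclidean_space"
  shows "cinner x x = complex_of_real ((norm x)\<^sup>2)"
proof (rule complex_eqI)
  show "Re (cinner x x) = Re (complex_of_real ((norm x)\<^sup>2))"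
    by (simp add: inner_eq_Re_cinner[symmetric] power2_norm_eq_inner)
  have "cinner x x = cnj (cinner x x)" by (rule cinner_commute)
  then have "Im (cinner x x) = - Im (cinner x x)" by (metis cnj.simps(2))
  then show "Im (cinner x x) = Im (complex_of_real ((norm x)\<^sup>2))" by simp
qed

instantiation complex :: complex_euclidean_space
begin
definition "scaleC_complex (a::complex) (x::complex) = a * x"
definition "cinner_complex (x::complex) (y::complex) = cnj x * y"
instance
  by standard
    (simp_all add: scaleC_complex_def cinner_complex_def algebra_simps scaleR_conv_of_real
      inner_complex_def)
end

instantiation vec :: (complex_euclidean_space, finite) complex_euclidean_space
begin
definition "scaleC_vec a (x :: 'a ^ 'b) = (\<chi> i. a *\<^sub>C (x $ i))"
definition "cinner_vec (x :: 'a ^ 'b) y = (\<Sum>i\<in>UNIV. cinner (x $ i) (y $ i))"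
instance
proof
  fix x y :: "'a ^ 'b"
  show "cinner x y = cnj (cinner y x)"
    unfolding cinner_vec_def cnj_sum by (rule sum.cong[OF refl cinner_commute])
qed (simp_all add: scaleC_vec_def cinner_vec_def vec_eq_iff scaleC_add_right scaleC_add_left
      scaleC_scaleC scaleR_scaleC cinner_add_right cinner_scaleC_right sum.distrib
      sum_distrib_left inner_vec_def inner_eq_Re_cinner)
end

definition hermitian_op :: "('a::complex_euclidean_space \<Rightarrow> 'a) \<Rightarrow> bool" where
  "hermitian_op A \<longleftrightarrow>
     Vector_Spaces.linear scaleC scaleC A \<and> (\<forall>x y. cinner (A x) y = cinner x (A y))"

definition exp_op :: "('a::complex_euclidean_space \<Rightarrow> 'a) \<Rightarrow> 'a \<Rightarrow> 'a" where
  "exp_op T x = (\<Sum>n. (T ^^ n) x /\<^sub>R fact n)"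

definition ketbra :: "'a::complex_euclidean_space \<Rightarrow> 'a \<Rightarrow> 'a \<Rightarrow> 'a" where
  "ketbra f g x = cinner g x *\<^sub>C f"

definition evolved_state ::
    "('a::complex_euclidean_space \<Rightarrow> 'a) \<Rightarrow> 'a \<Rightarrow> real \<Rightarrow> 'a" where
  "evolved_state A \<psi> \<theta> = exp_op (\<lambda>x. (- \<i> * complex_of_real \<theta>) *\<^sub>C A x) \<psi>"

definition weak_value ::
    "('a::complex_euclidean_space \<Rightarrow> 'a) \<Rightarrow> 'a \<Rightarrow> 'a \<Rightarrow> complex" where
  "weak_value A \<psi> f = cinner \<psi> (A f) / cinner \<psi> f"

definition overlap_prob :: "'a::complex_euclidean_space \<Rightarrow> 'a \<Rightarrow> real" where
  "overlap_prob \<psi> f = (cmod (cinner \<psi> f))\<^sup>2"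

text \<open>
  \<open>\<Psi>\<close> is the curve of unnormalized postselected states and \<open>p\<close> the postselection probability.
  Taking the real part of \<open>\<langle>\<Psi>'|\<Psi>'\<rangle>\<close> only changes the type, see \<open>cinner_self_eq_norm\<close>.
\<close>

definition postselected_qfi ::
    "real \<Rightarrow> (real \<Rightarrow> 'a::complex_euclidean_space) \<Rightarrow> real \<Rightarrow> real" where
  "postselected_qfi p \<Psi> \<theta> =
     (let d\<Psi> = vector_derivative \<Psi> (at \<theta>)
      in 4 / p * Re (cinner d\<Psi> d\<Psi>) - 4 / p\<^sup>2 * (cmod (cinner d\<Psi> (\<Psi> \<theta>)))\<^sup>2)"

end

(* Write a_k = <f_k|\<psi>> and b_k = <A f_k|\<psi>> at \<theta>.  Pairing the exponential series with f_k gives a scalar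
   power series, and moving A across the inner product shows that a_k has derivative -i b_k.
   Hence the information times p^2 is
   4 (sum |a_k|^2 sum |b_k|^2 - |sum a_k cnj(b_k)|^2), and Lagrange's identity turns this into
   4 sum_{i<j} |a_i b_j - a_j b_i|^2.  Dividing by a_i a_j produces the weak values, which are
   cnj(b_k / a_k). *)

theory Submission
  imports Defs
begin

lemma bounded_linear_cinner_right: "bounded_linear (cinner x)"
  for x :: "'a::complex_euclidean_space"
  by (rule linear_conv_bounded_linear[THEN iffD1, OF linearI])
    (simp_all add: cinner_add_right cinner_scaleC_right scaleR_scaleC scaleC_complex_def)

lemma bounded_linear_scaleC_left: "bounded_linear (\<lambda>z. z *\<^sub>C x)"
  for x :: "'a::complex_euclidean_space"
  by (rule linear_conv_bounded_linear[THEN iffD1, OF linearI])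
    (simp_all add: scaleC_add_left scaleR_scaleC scaleC_scaleC scaleC_complex_def)

lemma bounded_linear_scaleC_right: "bounded_linear (\<lambda>x. a *\<^sub>C (x :: 'a::complex_euclidean_space))"
  by (rule linear_conv_bounded_linear[THEN iffD1, OF linearI])
    (simp_all add: scaleC_add_right scaleR_scaleC scaleC_scaleC mult.commute)

text \<open>In finite dimension linearity already implies boundedness; the convergence of the
  exponential series rests on this.\<close>

lemma hermitian_op_bounded_linear:
  assumes "hermitian_op A"
  shows "bounded_linear A"
proof -
  interpret Vector_Spaces.linear scaleC scaleC A
    using assms by (simp add: hermitian_op_def)
  show ?thesis
    by (rule linear_conv_bounded_linear[THEN iffD1, OF linearI]) (simp_all add: add scale scaleR_scaleC)
qed

text \<open>\<open>exp_op\<close> is an infinite sum, so it only carries information once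
  convergence is known. A bound \<open>K\<close> for \<open>T\<close> gives
  \<open>K ^ n * norm x\<close> for the n-th iterate, and the scalar exponential series
  dominates.\<close>

lemma summable_exp_op:
  fixes T :: "'a::banach \<Rightarrow> 'a"
  assumes "bounded_linear T"
  shows "summable (\<lambda>n. (T ^^ n) x /\<^sub>R fact n)"
proof -
  obtain K where K: "K > 0" "\<And>y. norm (T y) \<le> norm y * K"
    using bounded_linear.pos_bounded[OF assms] by blast
  have bound: "norm ((T ^^ n) x) \<le> K ^ n * norm x" for n
  proof (induction n)
    case (Suc n)
    have "norm ((T ^^ Suc n) x) \<le> norm ((T ^^ n) x) * K" using K(2) by simp
    also have "\<dots> \<le> (K ^ n * norm x) * K" using Suc K(1) by (intro mult_right_mono) auto
    finally show ?case by (simp add: mult_ac)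
  qed simp
  show ?thesis
  proof (rule summable_comparison_test')
    show "summable (\<lambda>n. norm x * (K ^ n /\<^sub>R fact n))"
      by (intro summable_mult summable_exp_generic)
    show "norm ((T ^^ n) x /\<^sub>R fact n) \<le> norm x * (K ^ n /\<^sub>R fact n)" if "n \<ge> 0" for n
      using bound[of n] by (simp add: divide_simps mult_ac)
  qed
qed

text \<open>The coefficients do not depend on \<open>t\<close>, so each overlap with the evolved
  state is an ordinary power series. This replaces differentiation of an operator exponential by
  termwise differentiation of scalars.\<close>

lemma cinner_evolved_state_sums:
  fixes A :: "'a::complex_euclidean_space \<Rightarrow> 'a"
  assumes "hermitian_op A"
  shows "(\<lambda>n. cinner g (((\<lambda>x. (- \<i>) *\<^sub>C A x) ^^ n) x) / fact n * of_real t ^ n)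
           sums cinner g (evolved_state A x t)"
proof -
  define B where "B = (\<lambda>x. (- \<i>) *\<^sub>C A x)"
  have lin: "bounded_linear (\<lambda>x. c *\<^sub>C A x)" for c
    using bounded_linear_compose[OF bounded_linear_scaleC_right hermitian_op_bounded_linear[OF assms]] .
  have T: "(\<lambda>x. (- \<i> * complex_of_real t) *\<^sub>C A x) = (\<lambda>x. t *\<^sub>R B x)"
    by (simp add: B_def scaleR_scaleC scaleC_scaleC mult.commute)
  have "linear B" unfolding B_def using lin by (rule bounded_linear.linear)
  then have pow: "((\<lambda>x. t *\<^sub>R B x) ^^ n) x = t ^ n *\<^sub>R (B ^^ n) x" for n
    by (induction n) (simp_all add: linear_scale)
  have "(\<lambda>n. (t ^ n *\<^sub>R (B ^^ n) x) /\<^sub>R fact n) sums evolved_state A x t"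
    using summable_sums[OF summable_exp_op[OF lin[of "- \<i> * complex_of_real t"], of x]]
    unfolding evolved_state_def exp_op_def T pow .
  from bounded_linear.sums[OF bounded_linear_cinner_right this]
  have "(\<lambda>n. cinner g ((t ^ n *\<^sub>R (B ^^ n) x) /\<^sub>R fact n)) sums cinner g (evolved_state A x t)" .
  then show ?thesis
    unfolding B_def[symmetric]
    by (simp add: scaleR_scaleC cinner_scaleC_right divide_inverse mult_ac del: scaleR_scaleR)
qed

text \<open>Differentiating shifts the coefficients by one, which leaves one extra outermost factor
  \<open>B\<close>; hermiticity moves its \<open>A\<close> onto the bra \<open>g\<close>.\<close>

lemma cinner_evolved_state_has_derivative:
  fixes A :: "'a::complex_euclidean_space \<Rightarrow> 'a"
  assumes "hermitian_op A"
  shows "((\<lambda>t. cinner g (evolved_state A x t)) has_vector_derivative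
           - \<i> * cinner (A g) (evolved_state A x t)) (at t)"
proof -
  define B where "B = (\<lambda>x. (- \<i>) *\<^sub>C A x)"
  define c where "c g n = cinner g ((B ^^ n) x) / fact n" for g n
  have sums: "(\<lambda>n. c g n * of_real t ^ n) sums cinner g (evolved_state A x t)" for g t
    unfolding c_def B_def by (rule cinner_evolved_state_sums[OF assms])
  \<comment> \<open>Termwise differentiation wants convergence at every complex \<open>z\<close>,
    while \<open>sums\<close> covers only real arguments. Convergence at the real point
    \<open>norm z + 1\<close> gives it on the disc of that radius, which contains
    \<open>z\<close>.\<close>
  have summable: "summable (\<lambda>n. c g n * z ^ n)" for z
  proof (rule powser_inside)
    show "summable (\<lambda>n. c g n * of_real (norm z + 1) ^ n)"
      by (rule sums_summable[OF sums])
    show "norm z < norm (complex_of_real (norm z + 1))"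
      by (simp del: of_real_add)
  qed
  have "cinner g (B y) = - \<i> * cinner (A g) y" for y
    using assms by (simp add: B_def cinner_scaleC_right hermitian_op_def)
  \<comment> \<open>The factor \<open>Suc n\<close> from \<open>diffs\<close> cancels against
    \<open>fact (Suc n)\<close>.\<close>
  then have "diffs (c g) n = - \<i> * c (A g) n" for n
    by (simp add: diffs_def c_def divide_simps del: of_nat_Suc)
  then have "(\<Sum>n. diffs (c g) n * of_real t ^ n) = - \<i> * cinner (A g) (evolved_state A x t)"
    using sums_unique[OF sums_mult[OF sums[of "A g" t], of "- \<i>"]] by (simp add: mult.assoc)
  then have "((\<lambda>z. \<Sum>n. c g n * z ^ n) has_field_derivative
      - \<i> * cinner (A g) (evolved_state A x t)) (at (of_real t))"
    using termdiffs_strong_converges_everywhere[OF summable, of "of_real t"] by simp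
  \<comment> \<open>The complex derivative at a real point restricts to the derivative along the
    real line.\<close>
  from has_vector_derivative_real_field[OF this] show ?thesis
    by (simp add: sums_unique[OF sums, symmetric])
qed

lemma cinner_sum_orthonormal:
  fixes f :: "'i \<Rightarrow> 'a::complex_euclidean_space"
  assumes "finite S" "\<And>j k. j \<in> S \<Longrightarrow> k \<in> S \<Longrightarrow> cinner (f j) (f k) = (if j = k then 1 else 0)"
  shows "cinner (\<Sum>j\<in>S. u j *\<^sub>C f j) (\<Sum>k\<in>S. v k *\<^sub>C f k) = (\<Sum>k\<in>S. cnj (u k) * v k)"
proof -
  have right: "cinner x (\<Sum>k\<in>S. v k *\<^sub>C f k) = (\<Sum>k\<in>S. v k * cinner x (f k))" for x v
    using bounded_linear.linear[OF bounded_linear_cinner_right[of x]]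
    by (simp add: linear_sum cinner_scaleC_right)
  \<comment> \<open>Antilinearity in the first argument comes from linearity in the second by
    conjugate symmetry.\<close>
  have "cinner (\<Sum>j\<in>S. u j *\<^sub>C f j) (f k) = cnj (u k)" if "k \<in> S" for k
  proof -
    have "cinner (f k) (\<Sum>j\<in>S. u j *\<^sub>C f j) = (\<Sum>j\<in>S. if k = j then u j else 0)"
      unfolding right by (rule sum.cong) (use assms(2) that in auto)
    then show ?thesis
      using assms(1) that by (subst cinner_commute) simp
  qed
  then show ?thesis by (simp add: right mult.commute cong: sum.cong)
qed

text \<open>The square of index pairs splits into two triangles, exchanged by swapping the indices,
  and a diagonal that contributes nothing.\<close>

lemma sum_symmetric_pairs:
  fixes h :: "nat \<Rightarrow> nat \<Rightarrow> 'b::comm_semiring_1"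
  assumes "\<And>i j. h i j = h j i" "\<And>i. h i i = 0"
  shows "(\<Sum>i=1..n. \<Sum>j=1..n. h i j) = 2 * (\<Sum>(i, j)\<in>{(i, j). 1 \<le> i \<and> i < j \<and> j \<le> n}. h i j)"
proof -
  let ?L = "{(i, j). 1 \<le> i \<and> i < j \<and> j \<le> n}"
  let ?U = "{(i, j). 1 \<le> j \<and> j < i \<and> i \<le> n}"
  let ?D = "{(i, j). 1 \<le> i \<and> i = j \<and> i \<le> n}"
  have fin: "finite ?L" "finite ?U" "finite ?D"
    by (rule finite_subset[of _ "{1..n} \<times> {1..n}"]; force)+
  have "(\<Sum>i=1..n. \<Sum>j=1..n. h i j) = (\<Sum>(i, j)\<in>{1..n} \<times> {1..n}. h i j)"
    by (simp add: sum.cartesian_product)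
  also have "{1..n} \<times> {1..n} = (?L \<union> ?U) \<union> ?D" by auto
  also have "(\<Sum>(i, j)\<in>(?L \<union> ?U) \<union> ?D. h i j) =
      (\<Sum>(i, j)\<in>?L. h i j) + (\<Sum>(i, j)\<in>?U. h i j) + (\<Sum>(i, j)\<in>?D. h i j)"
    using fin by (subst sum.union_disjoint; (subst sum.union_disjoint)?; auto)
  also have "(\<Sum>(i, j)\<in>?U. h i j) = (\<Sum>(i, j)\<in>?L. h i j)"
    by (rule sum.reindex_bij_witness[of _ prod.swap prod.swap]) (auto simp: assms(1))
  also have "(\<Sum>(i, j)\<in>?D. h i j) = 0"
    by (rule sum.neutral) (auto simp: assms(2))
  finally show ?thesis by (simp add: mult_2)
qed

text \<open>Summed over all ordered pairs, the squared 2x2 determinants expand to twice the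
  left-hand side; symmetry then halves the range of summation.\<close>

lemma Lagrange_identity_complex:
  fixes a b :: "nat \<Rightarrow> complex"
  shows "(\<Sum>k=1..n. (cmod (a k))\<^sup>2) * (\<Sum>k=1..n. (cmod (b k))\<^sup>2) - (cmod (\<Sum>k=1..n. a k * cnj (b k)))\<^sup>2
    = (\<Sum>(i, j)\<in>{(i, j). 1 \<le> i \<and> i < j \<and> j \<le> n}. (cmod (a i * b j - a j * b i))\<^sup>2)"
proof -
  let ?h = "\<lambda>i j. (cmod (a i * b j - a j * b i))\<^sup>2"
  let ?P = "\<Sum>k=1..n. a k * cnj (a k)" and ?Q = "\<Sum>k=1..n. b k * cnj (b k)"
    and ?R = "\<Sum>k=1..n. a k * cnj (b k)" and ?R' = "\<Sum>k=1..n. b k * cnj (a k)"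
  \<comment> \<open>Each term is bracketed as a factor in \<open>i\<close> times a factor in
    \<open>j\<close>, so that its double sum is a product of two single sums.\<close>
  have "complex_of_real (?h i j) =
      (a i * cnj (a i)) * (b j * cnj (b j)) + (b i * cnj (b i)) * (a j * cnj (a j))
      - (a i * cnj (b i)) * (b j * cnj (a j)) - (b i * cnj (a i)) * (a j * cnj (b j))" for i j
    unfolding complex_norm_square by (simp add: algebra_simps)
  then have "complex_of_real (\<Sum>i=1..n. \<Sum>j=1..n. ?h i j) = ?P * ?Q + ?Q * ?P - ?R * ?R' - ?R' * ?R"
    unfolding sum_product of_real_sum by (simp only: sum.distrib sum_subtractf)
  moreover have "?P = complex_of_real (\<Sum>k=1..n. (cmod (a k))\<^sup>2)"
    by (simp only: complex_norm_square of_real_sum)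
  moreover have "?Q = complex_of_real (\<Sum>k=1..n. (cmod (b k))\<^sup>2)"
    by (simp only: complex_norm_square of_real_sum)
  \<comment> \<open>\<open>?R'\<close> is the conjugate of \<open>?R\<close>.\<close>
  moreover have "?R * ?R' = complex_of_real ((cmod ?R)\<^sup>2)"
    unfolding complex_norm_square cnj_sum by (simp add: mult.commute)
  ultimately have "complex_of_real (\<Sum>i=1..n. \<Sum>j=1..n. ?h i j) = complex_of_real
      (2 * ((\<Sum>k=1..n. (cmod (a k))\<^sup>2) * (\<Sum>k=1..n. (cmod (b k))\<^sup>2) - (cmod ?R)\<^sup>2))"
    by (simp only: mult.commute[of ?R' ?R] mult.commute[of ?Q ?P] of_real_mult of_real_diff)
      (simp only: of_real_numeral mult_2 algebra_simps)
  then have "2 * ((\<Sum>k=1..n. (cmod (a k))\<^sup>2) * (\<Sum>k=1..n. (cmod (b k))\<^sup>2) - (cmod ?R)\<^sup>2)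
      = (\<Sum>i=1..n. \<Sum>j=1..n. ?h i j)"
    by (simp only: of_real_eq_iff)
  also have "\<dots> = 2 * (\<Sum>(i, j)\<in>{(i, j). 1 \<le> i \<and> i < j \<and> j \<le> n}. ?h i j)"
    by (rule sum_symmetric_pairs) (simp_all add: norm_minus_commute)
  finally show ?thesis by simp
qed

theorem mainTheorem2:
  fixes A F :: "'a::complex_euclidean_space \<Rightarrow> 'a"
    and \<psi>\<^sub>i :: 'a
    and f :: "nat \<Rightarrow> 'a"
    and n :: nat
    and \<theta> :: real
    and \<psi> :: "real \<Rightarrow> 'a"
    and p\<^sub>k :: "nat \<Rightarrow> real"
    and p :: real
    and A\<^sub>w :: "nat \<Rightarrow> complex"
  assumes "hermitian_op A"
    and "norm \<psi>\<^sub>i = 1"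
    and "n \<ge> 1"
    and "\<forall>j\<in>{1..n}. \<forall>k\<in>{1..n}. cinner (f j) (f k) = (if j = k then 1 else 0)"
    and "F = (\<lambda>x. \<Sum>k=1..n. ketbra (f k) (f k) x)"
    and "\<psi> = evolved_state A \<psi>\<^sub>i"
    and "\<forall>k\<in>{1..n}. cinner (\<psi> \<theta>) (f k) \<noteq> 0"
    and "p\<^sub>k = (\<lambda>k. overlap_prob (\<psi> \<theta>) (f k))"
    and "p = (\<Sum>k=1..n. p\<^sub>k k)"
    and "A\<^sub>w = (\<lambda>k. weak_value A (\<psi> \<theta>) (f k))"
  shows "postselected_qfi p (\<lambda>t. F (\<psi> t)) \<theta> * p\<^sup>2 =
    4 * (\<Sum>(i, j)\<in>{(i, j). 1 \<le> i \<and> i < j \<and> j \<le> n}.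
           p\<^sub>k i * p\<^sub>k j * (cmod (A\<^sub>w i - A\<^sub>w j))\<^sup>2)"
proof -
  \<comment> \<open>With the state on the right, \<open>a t k\<close> is the coordinate of
    \<open>F (\<psi> t)\<close> along \<open>f k\<close>. The overlaps in the statement are its
    conjugates, hence the \<open>cnj\<close> in the weak values below.\<close>
  define a where "a t k = cinner (f k) (\<psi> t)" for t k
  define b where "b k = cinner (A (f k)) (\<psi> \<theta>)" for k
  have a_nz: "a \<theta> k \<noteq> 0" if "k \<in> {1..n}" for k
    using assms(7) that cinner_commute[of "\<psi> \<theta>" "f k"] by (auto simp: a_def)
  have pk: "p\<^sub>k k = (cmod (a \<theta> k))\<^sup>2" for k
    unfolding assms(8) overlap_prob_def a_def by (subst cinner_commute) simp
  have p: "p = (\<Sum>k=1..n. (cmod (a \<theta> k))\<^sup>2)"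
    unfolding assms(9) pk ..
  have weak: "A\<^sub>w k = cnj (b k) / cnj (a \<theta> k)" for k
    unfolding assms(10) weak_value_def a_def b_def
    using cinner_commute[of "\<psi> \<theta>" "f k"] cinner_commute[of "\<psi> \<theta>" "A (f k)"] by simp
  \<comment> \<open>Needed to cancel the denominators \<open>p\<close> and \<open>p\<^sup>2\<close>
    in the Fisher information; \<open>n \<ge> 1\<close> makes the sum nonempty.\<close>
  have "p > 0"
    unfolding p by (rule sum_pos) (use assms(3) a_nz in auto)
  have F: "F (\<psi> t) = (\<Sum>k=1..n. a t k *\<^sub>C f k)" for t
    unfolding assms(5) ketbra_def a_def ..
  have "((\<lambda>t. a t k) has_vector_derivative - \<i> * b k) (at \<theta>)" for k
    unfolding a_def b_def assms(6) by (rule cinner_evolved_state_has_derivative[OF assms(1)])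
  then have "((\<lambda>t. F (\<psi> t)) has_vector_derivative (\<Sum>k=1..n. (- \<i> * b k) *\<^sub>C f k)) (at \<theta>)"
    unfolding F
    by (intro has_vector_derivative_sum
        bounded_linear.has_vector_derivative[OF bounded_linear_scaleC_left])
  then have d: "vector_derivative (\<lambda>t. F (\<psi> t)) (at \<theta>) = (\<Sum>k=1..n. (- \<i> * b k) *\<^sub>C f k)"
    (is "_ = ?d") by (rule vector_derivative_at)
  have ortho: "cinner (f j) (f k) = (if j = k then 1 else 0)" if "j \<in> {1..n}" "k \<in> {1..n}" for j k
    using assms(4) that by blast
  have "cinner ?d ?d = (\<Sum>k=1..n. cnj (- \<i> * b k) * (- \<i> * b k))"
    by (rule cinner_sum_orthonormal[OF _ ortho]) auto
  also have "\<dots> = complex_of_real (\<Sum>k=1..n. (cmod (b k))\<^sup>2)"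
    by (simp add: complex_norm_square algebra_simps del: of_real_power)
  finally have dd: "Re (cinner ?d ?d) = (\<Sum>k=1..n. (cmod (b k))\<^sup>2)" by simp
  have "cinner ?d (F (\<psi> \<theta>)) = (\<Sum>k=1..n. cnj (- \<i> * b k) * a \<theta> k)"
    unfolding F by (rule cinner_sum_orthonormal[OF _ ortho]) auto
  \<comment> \<open>The common phase has modulus one and disappears under
    \<open>cmod\<close>.\<close>
  also have "\<dots> = \<i> * (\<Sum>k=1..n. a \<theta> k * cnj (b k))"
    by (simp add: sum_distrib_left mult_ac)
  finally have dF: "cmod (cinner ?d (F (\<psi> \<theta>))) = cmod (\<Sum>k=1..n. a \<theta> k * cnj (b k))"
    by (simp add: norm_mult)
  have "postselected_qfi p (\<lambda>t. F (\<psi> t)) \<theta> * p\<^sup>2 =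
      4 * (p * (\<Sum>k=1..n. (cmod (b k))\<^sup>2) - (cmod (\<Sum>k=1..n. a \<theta> k * cnj (b k)))\<^sup>2)"
    unfolding postselected_qfi_def Let_def d dd dF
    using \<open>p > 0\<close> by (simp add: field_simps power2_eq_square)
  also have "\<dots> = 4 * (\<Sum>(i, j)\<in>{(i, j). 1 \<le> i \<and> i < j \<and> j \<le> n}.
      (cmod (a \<theta> i * b j - a \<theta> j * b i))\<^sup>2)"
    unfolding p Lagrange_identity_complex ..
  also have "(\<Sum>(i, j)\<in>{(i, j). 1 \<le> i \<and> i < j \<and> j \<le> n}. (cmod (a \<theta> i * b j - a \<theta> j * b i))\<^sup>2) =
      (\<Sum>(i, j)\<in>{(i, j). 1 \<le> i \<and> i < j \<and> j \<le> n}. p\<^sub>k i * p\<^sub>k j * (cmod (A\<^sub>w i - A\<^sub>w j))\<^sup>2)"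
  proof (rule sum.cong[OF refl], clarify)
    fix i j assume ij: "1 \<le> i" "i < j" "j \<le> n"
    have nz: "a \<theta> i \<noteq> 0" "a \<theta> j \<noteq> 0" using ij a_nz by auto
    \<comment> \<open>Pulling both overlaps out of the determinant leaves a difference of quotients
      \<open>b / a\<close>; conjugation turns these into weak values. Neither the conjugation nor
      the reversed order affects the modulus.\<close>
    have "cnj (a \<theta> i * b j - a \<theta> j * b i) = cnj (a \<theta> i) * cnj (a \<theta> j) * (A\<^sub>w j - A\<^sub>w i)"
      unfolding weak using nz by (simp add: field_simps)
    then have "cmod (a \<theta> i * b j - a \<theta> j * b i) = cmod (a \<theta> i) * cmod (a \<theta> j) * cmod (A\<^sub>w i - A\<^sub>w j)"
      by (metis complex_mod_cnj norm_minus_commute norm_mult)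
    then show "(cmod (a \<theta> i * b j - a \<theta> j * b i))\<^sup>2 = p\<^sub>k i * p\<^sub>k j * (cmod (A\<^sub>w i - A\<^sub>w j))\<^sup>2"
      unfolding pk by (simp add: power_mult_distrib)
  qed
  finally show ?thesis .
qed

end
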